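(* Let $d>1$ be an integer, $\mathbb{O}_d=(\mathbb{R}_+)^d$, $F,G:\mathbb{O}_d\times\mathbb{R}^d\to\mathbb{R}^d$, $U_0:\mathbb{O}_d\to\mathbb{R}^d$, $\lambda>0$ and $T\in\mathcal{L}(\mathbb{R}^d)$. Assume: (i) for every $x\in\mathbb{O}_d$, $p\in\mathbb{R}^d$ and $i\in\{1,\dots,d\}$, $x^i=0$ implies $F^i(x,p)\le 0$; moreover $T(\mathbb{O}_d)\subset\mathbb{O}_d$; (ii) $U_0$ is monotone, i.e. $\langle U_0(x)-U_0(y),x-y\rangle\ge0$ for all $x,y\in\mathbb{O}_d$, and $(G,F)$ is monotone, i.e. $\langle G(x,p)-G(y,q),x-y\rangle+\langle F(x,p)-F(y,q),p-q\rangle\ge 0$ for all $x,y\in\mathbb{O}_d$, $p,q\in\mathbb{R}^d$. Then there exists at most one uniformly continuous monotone solution $U:[0,\infty)\times\mathbb{O}_d\to\mathbb{R}^d$ of the master equation $$\partial_tU+(F(x,U)\cdot\nabla_x)U+\lambda\,(U-T^*U(t,Tx))=G(x,U)\ \text{ in }(0,\infty)\times\mathbb{O}_d,\qquad U(0,x)=U_0(x)\ \text{ in }\mathbb{O}_d .$$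
   Context: Notation: $B^1_R=\{x\in\mathbb{O}_d:\ x_1+\dots+x_d\le R\}$; $T^*$ is the adjoint of $T$; $\langle\cdot,\cdot\rangle$ is the Euclidean scalar product. Definition (monotone solution, time-dependent case). A function $U$ is a monotone solution of the master equation if: (1) for any $V\in\mathbb{R}^d$, $y\in\mathbb{O}_d$ and sufficiently large $R>0$ (i.e. any $R\ge R_0$ for some $R_0>0$ independent of the other data), for any $(t_0,x_0)\in(0,\infty)\times B^1_R$ such that $x_0$ is a point of strict minimum on $B^1_R$ of $x\mapsto\langle U(t_0,x)-V,x-y\rangle$ (the minimum over $B_R^1$ is attained at $x_0$ and only there), and for any smooth real function $\phi$ such that for some $\epsilon>0$, $\phi(t)<\langle U(t,x_0),x_0-y\rangle$ for $t\in(t_0-\epsilon,t_0)$, and $\phi(t_0)=\langle U(t_0,x_0),x_0-y\rangle$, one has $$\frac{d}{dt}\phi(t_0)+\lambda\langle U(t_0,x_0)-T^*U(t_0,Tx_0),x_0-y\rangle\ \ge\ \langle F(x_0,U(t_0,x_0)),U(t_0,x_0)-V\rangle+\langle G(x_0,U(t_0,x_0)),x_0-y\rangle ;$$ (2) $U(0,x)=U_0(x)$ for all $x\in\mathbb{O}_d$. *)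

theory Defs
  imports "HOL-Analysis.Analysis"
begin

definition orthant :: "(real ^ 'n) set" where
  "orthant = {x. \<forall>i. 0 \<le> x $ i}"

definition orthant_ball :: "real \<Rightarrow> (real ^ 'n) set" where
  "orthant_ball R = {x \<in> orthant. (\<Sum>i\<in>UNIV. x $ i) \<le> R}"

definition monotone_on_orthant :: "(real ^ 'n \<Rightarrow> real ^ 'n) \<Rightarrow> bool" where
  "monotone_on_orthant U \<longleftrightarrow> (\<forall>x\<in>orthant. \<forall>y\<in>orthant. 0 \<le> (U x - U y) \<bullet> (x - y))"

definition monotone_pair ::
  "(real ^ 'n \<Rightarrow> real ^ 'n \<Rightarrow> real ^ 'n) \<Rightarrow> (real ^ 'n \<Rightarrow> real ^ 'n \<Rightarrow> real ^ 'n) \<Rightarrow> bool" where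
  "monotone_pair G F \<longleftrightarrow>
     (\<forall>x\<in>orthant. \<forall>y\<in>orthant. \<forall>p q.
        0 \<le> (G x p - G y q) \<bullet> (x - y) + (F x p - F y q) \<bullet> (p - q))"

definition strict_min_at :: "('a \<Rightarrow> real) \<Rightarrow> 'a set \<Rightarrow> 'a \<Rightarrow> bool" where
  "strict_min_at f S x0 \<longleftrightarrow> x0 \<in> S \<and> (\<forall>x\<in>S. x \<noteq> x0 \<longrightarrow> f x0 < f x)"

definition smooth_fun :: "(real \<Rightarrow> real) \<Rightarrow> bool" where
  "smooth_fun \<phi> \<longleftrightarrow> (\<forall>n. (deriv ^^ n) \<phi> differentiable_on UNIV)"

text \<open>
  Functions on the orthant or on \<open>[0,\<infinity>)\<close> times the orthant are modelled by total functions whose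
  values outside these sets are irrelevant. In particular the interval \<open>(t0 - \<epsilon>, t0)\<close> below may
  reach negative times, but since \<open>\<epsilon>\<close> can be shrunk this does not affect the definition.
\<close>

definition monotone_solution ::
  "(real ^ 'n \<Rightarrow> real ^ 'n \<Rightarrow> real ^ 'n) \<Rightarrow> (real ^ 'n \<Rightarrow> real ^ 'n \<Rightarrow> real ^ 'n) \<Rightarrow> real \<Rightarrow>
   (real ^ 'n \<Rightarrow> real ^ 'n) \<Rightarrow> (real ^ 'n \<Rightarrow> real ^ 'n) \<Rightarrow> (real \<Rightarrow> real ^ 'n \<Rightarrow> real ^ 'n) \<Rightarrow> bool"
where
  "monotone_solution F G lam T U0 U \<longleftrightarrow>
     (\<exists>R0>0. \<forall>V. \<forall>y\<in>orthant. \<forall>R\<ge>R0. \<forall>t0>0. \<forall>x0\<in>orthant_ball R. \<forall>\<phi>.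
        strict_min_at (\<lambda>x. (U t0 x - V) \<bullet> (x - y)) (orthant_ball R) x0 \<longrightarrow>
        smooth_fun \<phi> \<longrightarrow>
        (\<exists>\<epsilon>>0. \<forall>t\<in>{t0 - \<epsilon><..<t0}. \<phi> t < U t x0 \<bullet> (x0 - y)) \<longrightarrow>
        \<phi> t0 = U t0 x0 \<bullet> (x0 - y) \<longrightarrow>
        deriv \<phi> t0 + lam * ((U t0 x0 - adjoint T (U t0 (T x0))) \<bullet> (x0 - y))
          \<ge> F x0 (U t0 x0) \<bullet> (U t0 x0 - V) + G x0 (U t0 x0) \<bullet> (x0 - y)) \<and>
     (\<forall>x\<in>orthant. U 0 x = U0 x)"

end

theory Submission
  imports Defs
begin

text \<open>
  Let \<open>w(t, s, x, y) = \<langle>U(t, x) - V(s, y), x - y\<rangle>\<close> for two solutions \<open>U\<close>, \<open>V\<close>. If \<open>w(t, t, \<cdot>, \<cdot>) \<ge> 0\<close>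
  on the orthant, Minty's argument (take \<open>y = x - \<epsilon>h\<close>, \<open>\<epsilon> \<rightarrow> 0\<close>) gives \<open>U = V\<close>.

  To bound \<open>w\<close> from below on \<open>B\<^sub>R\<close>, double the time variable and minimise over \<open>B\<^sub>R \<times> B\<^sub>R\<close> the function
  \<open>w + a(t - s)\<^sup>2 + b(e\<^sup>c\<^sup>t + e\<^sup>c\<^sup>s) + \<delta>(t + s) - \<kappa>|x|\<^sup>2 - \<kappa>|y|\<^sup>2\<close>. The concave term makes Stegall's lemma
  elementary: if \<open>f - \<kappa>|x|\<^sup>2\<close> is minimal at \<open>x\<^sub>0\<close>, then the linear perturbation \<open>f - 2\<kappa>\<langle>x, x\<^sub>0\<rangle>\<close> has a
  strict minimum there, and a linear perturbation is absorbed by the vector in the definition of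
  a monotone solution. The error \<open>\<kappa>\<langle>F, x\<^sub>0\<rangle>\<close> vanishes with \<open>\<kappa>\<close> although \<open>F\<close> need not be continuous,
  because the \<open>F\<close> component of a monotone pair is locally bounded up to the boundary of the orthant.

  Since \<open>T\<close> does not preserve \<open>B\<^sub>R\<close>, this only yields: if \<open>w(t, t, Tx, Ty) \<ge> -B e\<^sup>c\<^sup>t\<close> on \<open>B\<^sub>R\<close>, then
  \<open>w(t, t, x, y) \<ge> -(\<lambda>B/c) e\<^sup>c\<^sup>t\<close> on \<open>B\<^sub>R\<close>. Uniformly continuous functions grow at most linearly, so
  \<open>w(t, t, x, y) \<ge> -C R\<^sup>2 e\<^sup>c\<^sup>t\<close> on every large \<open>B\<^sub>R\<close>; if \<open>T B\<^sub>R \<subseteq> B\<^sub>k\<^sub>R\<close> and \<open>c = 2\<lambda>k\<^sup>2\<close>, the previous step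
  halves \<open>C\<close>, and iterating gives \<open>w \<ge> 0\<close>.
\<close>

section \<open>Truncated orthants and smooth test functions in time\<close>

lemma orthant_ballD:
  assumes "x \<in> orthant_ball R"
  shows "x \<in> orthant" and "norm x \<le> R"
proof -
  show o: "x \<in> orthant" using assms by (simp add: orthant_ball_def)
  have "norm x \<le> (\<Sum>i\<in>UNIV. \<bar>x $ i\<bar>)" by (rule norm_le_l1_cart)
  also have "\<dots> = (\<Sum>i\<in>UNIV. x $ i)" using o by (intro sum.cong) (auto simp: orthant_def)
  also have "\<dots> \<le> R" using assms by (simp add: orthant_ball_def)
  finally show "norm x \<le> R" .
qed

lemma orthant_ballI:
  fixes x :: "real ^ 'n"
  assumes "x \<in> orthant" "real CARD('n) * norm x \<le> R"
  shows "x \<in> orthant_ball R"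
proof -
  have "(\<Sum>i\<in>UNIV. x $ i) \<le> (\<Sum>i\<in>(UNIV::'n set). norm x)"
    by (intro sum_mono) (metis abs_le_D1 component_le_norm_cart)
  then show ?thesis using assms by (simp add: orthant_ball_def)
qed

lemma closed_orthant: "closed (orthant :: (real ^ 'n) set)"
  unfolding orthant_def by (intro closed_Collect_all closed_Collect_le continuous_intros)

lemma compact_orthant_ball: "compact (orthant_ball R :: (real ^ 'n) set)"
proof -
  have "closed (orthant_ball R :: (real ^ 'n) set)"
  proof -
    have "orthant_ball R = orthant \<inter> {x :: real ^ 'n. (\<Sum>i\<in>UNIV. x $ i) \<le> R}"
      by (auto simp: orthant_ball_def)
    then show ?thesis
      by (simp only:) (intro closed_Int closed_orthant closed_Collect_le continuous_intros)
  qed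
  moreover have "bounded (orthant_ball R :: (real ^ 'n) set)"
    by (meson bounded_iff orthant_ballD(2))
  ultimately show ?thesis by (simp add: compact_eq_bounded_closed)
qed

text \<open>The family is closed under differentiation, so induction on the order of the derivative
  succeeds once the coefficients \<open>q\<close>, \<open>r\<close>, \<open>d\<close>,
  \<open>k\<close> are generalised.\<close>

lemma smooth_fun_quadratic_plus_exp:
  "smooth_fun (\<lambda>t. q * t\<^sup>2 + r * t + d + k * exp (c * t))"
proof -
  \<comment> \<open>The vacuous term \<open>0 * t\<^sup>2\<close> keeps the derivative syntactically
    inside the family, so that the induction hypothesis matches.\<close>
  have D: "((\<lambda>t. q * t\<^sup>2 + r * t + d + k * exp (c * t)) has_real_derivative
             0 * t\<^sup>2 + (2 * q) * t + r + (k * c) * exp (c * t)) (at t)" for q r d k t :: real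
    by (auto intro!: derivative_eq_intros)
  have E: "deriv (\<lambda>t. q * t\<^sup>2 + r * t + d + k * exp (c * t))
      = (\<lambda>t. 0 * t\<^sup>2 + (2 * q) * t + r + (k * c) * exp (c * t))" for q r d k :: real
    by (rule ext) (rule DERIV_imp_deriv[OF D])
  have "(deriv ^^ n) (\<lambda>t. q * t\<^sup>2 + r * t + d + k * exp (c * t)) differentiable_on UNIV" for n
  proof (induction n arbitrary: q r d k)
    case 0
    show ?case
      using D[of q r d k] by (auto simp: differentiable_on_def real_differentiable_def simp del: mult_zero_left)
  next
    case (Suc n)
    show ?case unfolding funpow_Suc_right o_apply E by (rule Suc.IH)
  qed
  then show ?thesis by (simp add: smooth_fun_def)
qed

section \<open>A priori bounds\<close>

lemma monotone_pair_inner_bounded_above: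
  fixes F G :: "real ^ 'n \<Rightarrow> real ^ 'n \<Rightarrow> real ^ 'n"
  assumes "monotone_pair G F"
  obtains C where "C \<ge> 0"
    and "\<And>x p. x \<in> orthant_ball R \<Longrightarrow> norm p \<le> P \<Longrightarrow> F x p \<bullet> x \<le> C"
proof -
  \<comment> \<open>Monotonicity against the vertices of a box bounds \<open>\<langle>(G, F)(x, p), z' - (x, p)\<rangle>\<close> from above for all
    \<open>z'\<close> in the box, uniformly in \<open>(x, p)\<close>; then take \<open>z' = (x, p + x)\<close>.\<close>
  define L where "L = \<bar>R\<bar> + \<bar>P\<bar>"
  define l u :: "(real ^ 'n) \<times> (real ^ 'n)" where "l = (0, \<chi> i. - L)" and "u = (\<chi> i. L, \<chi> i. L)"
  have cb: "cbox l u = cbox 0 (\<chi> i. L) \<times> cbox (\<chi> i. - L) (\<chi> i. L)"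
    unfolding l_def u_def by (simp add: cbox_Pair_eq)
  have box: "(x, p) \<in> cbox l u \<longleftrightarrow> (\<forall>i. 0 \<le> x $ i \<and> x $ i \<le> L) \<and> (\<forall>i. - L \<le> p $ i \<and> p $ i \<le> L)" for x p
    by (simp add: cb mem_box_cart)
  obtain S where S: "finite S" "cbox l u = convex hull S"
    using closed_interval_as_convex_hull by blast
  \<comment> \<open>\<open>C\<close> involves \<open>F\<close> and \<open>G\<close> only at the
    finitely many vertices, hence does not depend on \<open>(x, p)\<close>.\<close>
  define C where "C = (\<Sum>(y, q)\<in>S. norm (G y q) * (\<bar>R\<bar> + norm y) + norm (F y q) * (\<bar>P\<bar> + norm q))"
  have "C \<ge> 0" unfolding C_def by (intro sum_nonneg) auto
  moreover have "F x p \<bullet> x \<le> C" if x: "x \<in> orthant_ball R" and p: "norm p \<le> P" for x p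
  proof -
    let ?H = "{z. (G x p, F x p) \<bullet> z \<le> G x p \<bullet> x + F x p \<bullet> p + C}"
    have "S \<subseteq> ?H"
    proof
      fix z assume z: "z \<in> S"
      obtain y q where zq: "z = (y, q)" by (cases z)
      have "z \<in> cbox l u" unfolding S(2) using z by (rule hull_inc)
      then have y: "y \<in> orthant" using box zq by (auto simp: orthant_def)
      have nx: "norm (x - y) \<le> \<bar>R\<bar> + norm y"
        using norm_triangle_ineq4[of x y] orthant_ballD(2)[OF x] by linarith
      have np: "norm (p - q) \<le> \<bar>P\<bar> + norm q"
        using norm_triangle_ineq4[of p q] p by linarith
      have "- (G y q \<bullet> (x - y)) \<le> norm (G y q) * (\<bar>R\<bar> + norm y)"
        using Cauchy_Schwarz_ineq2[of "G y q" "x - y"] mult_left_mono[OF nx norm_ge_zero[of "G y q"]]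
        by linarith
      moreover have "- (F y q \<bullet> (p - q)) \<le> norm (F y q) * (\<bar>P\<bar> + norm q)"
        using Cauchy_Schwarz_ineq2[of "F y q" "p - q"] mult_left_mono[OF np norm_ge_zero[of "F y q"]]
        by linarith
      moreover have "norm (G y q) * (\<bar>R\<bar> + norm y) + norm (F y q) * (\<bar>P\<bar> + norm q) \<le> C"
        unfolding C_def
        using member_le_sum[OF z, of "\<lambda>(y, q). norm (G y q) * (\<bar>R\<bar> + norm y) + norm (F y q) * (\<bar>P\<bar> + norm q)"]
          S(1) zq by auto
      moreover have "0 \<le> (G x p - G y q) \<bullet> (x - y) + (F x p - F y q) \<bullet> (p - q)"
        using assms orthant_ballD(1)[OF x] y by (auto simp: monotone_pair_def)
      ultimately show "z \<in> ?H"
        using zq by (simp add: inner_diff_left inner_diff_right)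
    qed
    then have "cbox l u \<subseteq> ?H"
      unfolding S(2) by (intro hull_minimal convex_halfspace_le) auto
    moreover have "(x, p + x) \<in> cbox l u"
    proof -
      have "0 \<le> x $ i \<and> x $ i \<le> L \<and> - L \<le> (p + x) $ i \<and> (p + x) $ i \<le> L" for i
      proof -
        have "0 \<le> x $ i" using orthant_ballD(1)[OF x] by (simp add: orthant_def)
        moreover have "\<bar>x $ i\<bar> \<le> \<bar>R\<bar>"
          using orthant_ballD(2)[OF x] component_le_norm_cart[of x i] by linarith
        moreover have "\<bar>p $ i\<bar> \<le> \<bar>P\<bar>"
          using p component_le_norm_cart[of p i] by linarith
        ultimately show ?thesis unfolding L_def vector_add_component by linarith
      qed
      then show ?thesis by (simp add: box)
    qed
    ultimately show ?thesis by (auto simp: inner_add_right)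
  qed
  ultimately show ?thesis using that by blast
qed

text \<open>The segment from 0 to \<open>z\<close> splits into about \<open>norm z / d\<close>
  pieces shorter than \<open>d\<close>, and \<open>f\<close> moves by less than 1 on each of
  them.\<close>

lemma uniformly_continuous_on_linear_growth:
  fixes f :: "'a::real_normed_vector \<Rightarrow> 'b::real_normed_vector"
  assumes f: "uniformly_continuous_on S f" and S: "convex S" "0 \<in> S"
  obtains C where "C > 0" and "\<And>z. z \<in> S \<Longrightarrow> norm (f z) \<le> C * (1 + norm z)"
proof -
  obtain d where d: "d > 0" "\<And>x y. x \<in> S \<Longrightarrow> y \<in> S \<Longrightarrow> dist x y < d \<Longrightarrow> dist (f x) (f y) < 1"
    using f unfolding uniformly_continuous_on_def by (metis zero_less_one)
  define C where "C = norm (f 0) + 1 + 1 / d"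
  have "C > 0" using d(1) by (simp add: C_def add_nonneg_pos)
  moreover have "norm (f z) \<le> C * (1 + norm z)" if z: "z \<in> S" for z
  proof -
    define n where "n = Suc (nat \<lfloor>norm z / d\<rfloor>)"
    have n: "norm z / d < real n" "real n \<le> norm z / d + 1"
      unfolding n_def using d(1) by (auto simp: of_nat_nat, linarith)
    have n0: "real n > 0" by (simp add: n_def)
    have mem: "(real k / real n) *\<^sub>R z \<in> S" if "k \<le> n" for k
      using convexD[OF S(1) z S(2), of "real k / real n" "1 - real k / real n"] that n0
      by (simp add: field_simps)
    have "norm (f ((real k / real n) *\<^sub>R z)) \<le> norm (f 0) + real k" if "k \<le> n" for k
      using that
    proof (induction k)
      case (Suc k)
      have "dist ((real (Suc k) / real n) *\<^sub>R z) ((real k / real n) *\<^sub>R z) = norm z / real n"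
        using n0 by (simp add: dist_norm scaleR_diff_left[symmetric] diff_divide_distrib[symmetric])
      also have "\<dots> < d" using n n0 d(1) by (simp add: field_simps)
      finally have "dist (f ((real (Suc k) / real n) *\<^sub>R z)) (f ((real k / real n) *\<^sub>R z)) < 1"
        using Suc.prems by (intro d(2) mem) auto
      then show ?case
        using Suc norm_triangle_ineq2[of "f ((real (Suc k) / real n) *\<^sub>R z)" "f ((real k / real n) *\<^sub>R z)"]
        by (simp add: dist_norm)
    qed simp
    from this[of n] have "norm (f z) \<le> norm (f 0) + real n" using n0 by simp
    also have "\<dots> \<le> C + norm z / d" using n(2) divide_pos_pos[OF zero_less_one d(1)] unfolding C_def by linarith
    also have "\<dots> \<le> C * (1 + norm z)"
    proof -
      have "(1 / d) * norm z \<le> C * norm z"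
        by (intro mult_right_mono) (auto simp: C_def)
      then show ?thesis by (simp add: algebra_simps)
    qed
    finally show ?thesis .
  qed
  ultimately show ?thesis using that by blast
qed

section \<open>Testing a solution at a penalised minimum\<close>

text \<open>The first clause of \<open>monotone_solution\<close> at a single radius, since the
  comparison on one truncated orthant tests both solutions at that radius only.\<close>

definition test_inequality ::
  "(real ^ 'n \<Rightarrow> real ^ 'n \<Rightarrow> real ^ 'n) \<Rightarrow> (real ^ 'n \<Rightarrow> real ^ 'n \<Rightarrow> real ^ 'n) \<Rightarrow> real \<Rightarrow>
   (real ^ 'n \<Rightarrow> real ^ 'n) \<Rightarrow> (real \<Rightarrow> real ^ 'n \<Rightarrow> real ^ 'n) \<Rightarrow> real \<Rightarrow> bool"
where
  "test_inequality F G lam T U R \<longleftrightarrow>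
     (\<forall>V. \<forall>y\<in>orthant. \<forall>t0>0. \<forall>x0\<in>orthant_ball R. \<forall>\<phi>.
        strict_min_at (\<lambda>x. (U t0 x - V) \<bullet> (x - y)) (orthant_ball R) x0 \<longrightarrow>
        smooth_fun \<phi> \<longrightarrow>
        (\<exists>\<epsilon>>0. \<forall>t\<in>{t0 - \<epsilon><..<t0}. \<phi> t < U t x0 \<bullet> (x0 - y)) \<longrightarrow>
        \<phi> t0 = U t0 x0 \<bullet> (x0 - y) \<longrightarrow>
        deriv \<phi> t0 + lam * ((U t0 x0 - adjoint T (U t0 (T x0))) \<bullet> (x0 - y))
          \<ge> F x0 (U t0 x0) \<bullet> (U t0 x0 - V) + G x0 (U t0 x0) \<bullet> (x0 - y))"

text \<open>This serves both solutions: one pair of variables \<open>(t, x)\<close> moves while the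
  other pair, with its value \<open>V\<close>, is frozen. Minimality in \<open>x\<close> supplies
  the strict minimum, and minimality in \<open>t\<close> supplies a test function touching from
  below.\<close>

lemma test_inequality_at_penalised_minimum:
  fixes U :: "real \<Rightarrow> real ^ 'n \<Rightarrow> real ^ 'n"
  assumes U: "test_inequality F G lam T U R" and T: "linear T"
    and y0: "y0 \<in> orthant" and x0: "x0 \<in> orthant_ball R" and t0: "0 < t0" "t0 \<le> M"
    and \<kappa>: "\<kappa> > 0" and \<delta>: "\<delta> > 0"
    and minx: "\<And>x. x \<in> orthant_ball R \<Longrightarrow>
      (U t0 x0 - V) \<bullet> (x0 - y0) - \<kappa> * (x0 \<bullet> x0) \<le> (U t0 x - V) \<bullet> (x - y0) - \<kappa> * (x \<bullet> x)"
    and mint: "\<And>t. 0 \<le> t \<Longrightarrow> t \<le> M \<Longrightarrow>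
      U t0 x0 \<bullet> (x0 - y0) + a * (t0 - s0)\<^sup>2 + b * exp (c * t0) + \<delta> * t0
      \<le> U t x0 \<bullet> (x0 - y0) + a * (t - s0)\<^sup>2 + b * exp (c * t) + \<delta> * t"
  shows "F x0 (U t0 x0) \<bullet> (U t0 x0 - V - (2 * \<kappa>) *\<^sub>R x0) + G x0 (U t0 x0) \<bullet> (x0 - y0)
    \<le> - (2 * a * (t0 - s0)) - b * c * exp (c * t0) - \<delta> / 2
       + lam * (U t0 x0 \<bullet> (x0 - y0) - U t0 (T x0) \<bullet> (T x0 - T y0))"
proof -
  \<comment> \<open>Only half of \<delta> enters \<open>K\<close> and \<phi>. The other half makes
    the contact at \<open>t0\<close> strict for earlier times.\<close>
  define K where "K = U t0 x0 \<bullet> (x0 - y0) + a * (t0 - s0)\<^sup>2 + b * exp (c * t0) + \<delta> / 2 * t0"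
  define \<phi> where "\<phi> = (\<lambda>t. (- a) * t\<^sup>2 + (2 * a * s0 - \<delta> / 2) * t + (K - a * s0\<^sup>2) + (- b) * exp (c * t))"
  have \<phi>: "\<phi> t = K - a * (t - s0)\<^sup>2 - b * exp (c * t) - \<delta> / 2 * t" for t
    by (simp add: \<phi>_def power2_eq_square algebra_simps)
  have smooth: "smooth_fun \<phi>"
    unfolding \<phi>_def by (rule smooth_fun_quadratic_plus_exp)
  have "(\<phi> has_real_derivative - (2 * a * (t0 - s0)) - b * c * exp (c * t0) - \<delta> / 2) (at t0)"
    unfolding \<phi>_def by (auto intro!: derivative_eq_intros simp: algebra_simps)
  then have deriv: "deriv \<phi> t0 = - (2 * a * (t0 - s0)) - b * c * exp (c * t0) - \<delta> / 2"
    by (rule DERIV_imp_deriv)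
  \<comment> \<open>The choice \<epsilon> = \<open>t0\<close> keeps the interval inside positive
    times, where \<open>mint\<close> applies.\<close>
  have below: "\<phi> t < U t x0 \<bullet> (x0 - y0)" if "t \<in> {t0 - t0<..<t0}" for t
  proof -
    have "\<delta> * t < \<delta> * t0" using that \<delta> by simp
    with mint[of t] that t0 show ?thesis by (simp add: \<phi> K_def)
  qed
  have touch: "\<phi> t0 = U t0 x0 \<bullet> (x0 - y0)" by (simp add: \<phi> K_def)
  have strict: "strict_min_at (\<lambda>x. (U t0 x - (V + (2 * \<kappa>) *\<^sub>R x0)) \<bullet> (x - y0)) (orthant_ball R) x0"
    unfolding strict_min_at_def
  proof (intro conjI ballI impI x0)
    fix x assume x: "x \<in> orthant_ball R" "x \<noteq> x0"
    \<comment> \<open>By completing the square, the perturbed function at \<open>x\<close> exceeds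
      its value at \<open>x0\<close> by at least \<kappa> |x - x0|^2.\<close>
    have "0 < \<kappa> * ((x - x0) \<bullet> (x - x0))" using \<kappa> x(2) by simp
    with minx[OF x(1)] show "(U t0 x0 - (V + (2 * \<kappa>) *\<^sub>R x0)) \<bullet> (x0 - y0)
        < (U t0 x - (V + (2 * \<kappa>) *\<^sub>R x0)) \<bullet> (x - y0)"
      by (simp add: inner_diff_left inner_diff_right inner_add_left inner_commute algebra_simps)
  qed
  have "deriv \<phi> t0 + lam * ((U t0 x0 - adjoint T (U t0 (T x0))) \<bullet> (x0 - y0))
      \<ge> F x0 (U t0 x0) \<bullet> (U t0 x0 - (V + (2 * \<kappa>) *\<^sub>R x0)) + G x0 (U t0 x0) \<bullet> (x0 - y0)"
    using U strict smooth below touch y0 x0 t0(1) unfolding test_inequality_def by blast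
  moreover have "adjoint T (U t0 (T x0)) \<bullet> (x0 - y0) = U t0 (T x0) \<bullet> (T x0 - T y0)"
    by (simp add: adjoint_works[OF T] inner_commute[of "adjoint T _"] inner_commute[of "U t0 _"] linear_diff[OF T])
  ultimately show ?thesis by (simp add: deriv inner_diff_left diff_diff_eq)
qed

section \<open>Minty's argument\<close>

text \<open>Moving from \<open>x\<close> in an arbitrary direction requires an interior point, so
  equality is proved there first and extended to the boundary by continuity.\<close>

lemma eq_on_orthant_of_cross_monotone:
  fixes f g :: "real ^ 'n \<Rightarrow> real ^ 'n"
  assumes f: "continuous_on orthant f" and g: "continuous_on orthant g"
    and mono: "\<And>x y. x \<in> orthant \<Longrightarrow> y \<in> orthant \<Longrightarrow> 0 \<le> (f x - g y) \<bullet> (x - y)"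
    and x: "x \<in> orthant"
  shows "f x = g x"
proof -
  define e where "e = (\<lambda>n. inverse (real (Suc n)))"
  have e: "e \<longlonglongrightarrow> 0" unfolding e_def by (rule LIMSEQ_inverse_real_of_nat)
  have e_pos: "e n > 0" for n by (simp add: e_def)
  have int: "f x = g x" if pos: "\<And>i. 0 < x $ i" for x
  proof -
    have xo: "x \<in> orthant" using pos by (auto simp: orthant_def less_imp_le)
    \<comment> \<open>With this direction the limit inequality
      \<open>0 \<le> (f x - g x) \<bullet> v\<close> reads
      \<open>0 \<le> - (v \<bullet> v)\<close>.\<close>
    define v where "v = g x - f x"
    define y where "y = (\<lambda>n. x - e n *\<^sub>R v)"
    have "y \<longlonglongrightarrow> x - 0 *\<^sub>R v" unfolding y_def by (intro tendsto_intros e)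
    then have y: "y \<longlonglongrightarrow> x" by simp
    have "\<forall>\<^sub>F n in sequentially. 0 < y n $ i" for i
      using tendsto_vec_nth[OF y] pos by (rule order_tendstoD(1))
    then have "\<forall>\<^sub>F n in sequentially. \<forall>i. 0 < y n $ i" by (rule eventually_all_finite)
    then have yo: "\<forall>\<^sub>F n in sequentially. y n \<in> orthant"
      by eventually_elim (auto simp: orthant_def less_imp_le)
    have gy: "(\<lambda>n. g (y n)) \<longlonglongrightarrow> g x"
      by (rule continuous_on_tendsto_compose[OF g y xo yo])
    have "\<forall>\<^sub>F n in sequentially. 0 \<le> (f x - g (y n)) \<bullet> v"
      using yo
    proof eventually_elim
      case (elim n)
      have "0 \<le> e n * ((f x - g (y n)) \<bullet> v)" using mono[OF xo elim] by (simp add: y_def)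
      then show ?case using e_pos[of n] by (simp add: zero_le_mult_iff)
    qed
    moreover have "(\<lambda>n. (f x - g (y n)) \<bullet> v) \<longlonglongrightarrow> (f x - g x) \<bullet> v"
      by (intro tendsto_inner tendsto_diff tendsto_const gy)
    ultimately have "0 \<le> (f x - g x) \<bullet> v"
      by (intro tendsto_lowerbound[OF _ _ sequentially_bot])
    then have "v \<bullet> v \<le> 0" by (simp add: v_def inner_diff_left)
    then show ?thesis
      by (metis antisym eq_iff_diff_eq_0 inner_eq_zero_iff inner_ge_zero v_def)
  qed
  \<comment> \<open>Adding a multiple of the all-ones vector \<open>1\<close> pushes a boundary
    point into the interior.\<close>
  define z where "z = (\<lambda>n. x + e n *\<^sub>R (1 :: real ^ 'n))"
  have "z \<longlonglongrightarrow> x + 0 *\<^sub>R 1" unfolding z_def by (intro tendsto_intros e)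
  then have z: "z \<longlonglongrightarrow> x" by simp
  have zpos: "0 < z n $ i" for n i
    using x e_pos[of n] by (auto simp: z_def orthant_def intro: add_nonneg_pos)
  then have zo: "\<forall>\<^sub>F n in sequentially. z n \<in> orthant" by (auto simp: orthant_def less_imp_le)
  have "(\<lambda>n. f (z n)) \<longlonglongrightarrow> f x" by (rule continuous_on_tendsto_compose[OF f z x zo])
  moreover have "(\<lambda>n. f (z n)) \<longlonglongrightarrow> g x"
    unfolding int[OF zpos] by (rule continuous_on_tendsto_compose[OF g z x zo])
  ultimately show ?thesis by (rule LIMSEQ_unique)
qed

section \<open>Comparison on one truncated orthant\<close>

lemma uniformly_continuous_on_time_modulus:
  fixes U :: "real \<Rightarrow> 'a::metric_space \<Rightarrow> 'b::real_normed_vector"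
  assumes U: "uniformly_continuous_on ({0..} \<times> S) (\<lambda>(t, x). U t x)" and "\<rho> > 0"
  obtains d where "d > (0 :: real)"
    and "\<And>t s x. 0 \<le> t \<Longrightarrow> 0 \<le> s \<Longrightarrow> \<bar>t - s\<bar> < d \<Longrightarrow> x \<in> S \<Longrightarrow> norm (U t x - U s x) < \<rho>"
proof -
  obtain d where d: "d > 0"
    "\<And>z z'. z \<in> {0..} \<times> S \<Longrightarrow> z' \<in> {0..} \<times> S \<Longrightarrow> dist z' z < d \<Longrightarrow>
       dist ((\<lambda>(t, x). U t x) z') ((\<lambda>(t, x). U t x) z) < \<rho>"
    using assms unfolding uniformly_continuous_on_def by metis
  show ?thesis
  proof (rule that[OF d(1)])
    fix t s x assume "0 \<le> t" "0 \<le> s" "\<bar>t - s\<bar> < d" "x \<in> S"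
    then show "norm (U t x - U s x) < \<rho>"
      using d(2)[of "(s, x)" "(t, x)"] by (simp add: dist_Pair_Pair dist_real_def dist_norm)
  qed
qed

text \<open>At the doubled minimum the two test inequalities and monotonicity of
  \<open>(G, F)\<close> leave only errors and the nonlocal term. The exponential weights are tuned
  to cancel the latter, and the errors consume at most 3/4 of the strict gain \<delta>.\<close>

lemma comparison_step:
  fixes U V :: "real \<Rightarrow> real ^ 'n \<Rightarrow> real ^ 'n"
  assumes lam: "lam > 0" and T: "linear T" "T ` orthant \<subseteq> orthant" and GF: "monotone_pair G F"
    and ucU: "uniformly_continuous_on ({0..} \<times> orthant) (\<lambda>(t, x). U t x)"
    and ucV: "uniformly_continuous_on ({0..} \<times> orthant) (\<lambda>(t, x). V t x)"
    and tU: "test_inequality F G lam T U R" and tV: "test_inequality F G lam T V R"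
    and init: "\<And>x y. x \<in> orthant \<Longrightarrow> y \<in> orthant \<Longrightarrow> 0 \<le> (U 0 x - V 0 y) \<bullet> (x - y)"
    and c: "c > 0" and B: "B \<ge> 0"
    and lower: "\<And>t x y. 0 \<le> t \<Longrightarrow> t \<le> M \<Longrightarrow> x \<in> orthant_ball R \<Longrightarrow> y \<in> orthant_ball R \<Longrightarrow>
      - (B * exp (c * t)) \<le> (U t (T x) - V t (T y)) \<bullet> (T x - T y)"
    and t1: "0 \<le> t1" "t1 \<le> M" and x1: "x1 \<in> orthant_ball R" and y1: "y1 \<in> orthant_ball R"
  shows "- (lam * B / c * exp (c * t1)) \<le> (U t1 x1 - V t1 y1) \<bullet> (x1 - y1)"
proof (rule ccontr)
  assume neg: "\<not> ?thesis"
  \<comment> \<open>Each of the two exponentials carries half of the claimed bound. Differentiating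
    both yields the total \<open>2 * (b * c) = lam * B\<close>, exactly the size of the nonlocal
    term.\<close>
  define b where "b = lam * B / c / 2"
  have b: "b \<ge> 0" "2 * (b * c) = lam * B" using lam B c by (auto simp: b_def)
  \<comment> \<open>\<eta> measures the assumed violation. The parameters \<delta>, \<kappa>,
    \<rho>, \<open>d\<close>, \<open>a\<close> are then fixed in this order, each in terms of
    earlier data only.\<close>
  define \<eta> where "\<eta> = - ((U t1 x1 - V t1 y1) \<bullet> (x1 - y1) + 2 * b * exp (c * t1))"
  have \<eta>: "\<eta> > 0" using neg by (simp add: \<eta>_def b_def)
  have M: "M \<ge> 0" using t1 by simp
  have R: "R \<ge> 0" using orthant_ballD(2)[OF x1] norm_ge_zero order_trans by blast
  define \<delta> where "\<delta> = \<eta> / (4 * (1 + M))"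
  have \<delta>: "\<delta> > 0" "2 * (\<delta> * M) \<le> \<eta> / 2" using \<eta> M by (auto simp: \<delta>_def field_simps)

  define K where "K = {0..M} \<times> {0..M} \<times> (orthant_ball R :: (real ^ 'n) set) \<times> (orthant_ball R :: (real ^ 'n) set)"
  have K: "compact K" unfolding K_def by (intro compact_Times compact_Icc compact_orthant_ball)
  have cont: "continuous_on A (\<lambda>z. W (f z) (g z))"
    if "uniformly_continuous_on ({0..} \<times> orthant) (\<lambda>(t, x). W t x)"
      and "continuous_on A f" "continuous_on A g" "f ` A \<subseteq> {0..}" "g ` A \<subseteq> orthant"
    for W :: "real \<Rightarrow> real ^ 'n \<Rightarrow> real ^ 'n" and A :: "'z::topological_space set" and f g
    using continuous_on_compose2[OF uniformly_continuous_imp_continuous[OF that(1)],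
        of A "\<lambda>z. (f z, g z)"] that(2-)
    by (auto intro!: continuous_intros)

  have bdd: "\<exists>P. \<forall>t x. 0 \<le> t \<longrightarrow> t \<le> M \<longrightarrow> x \<in> orthant_ball R \<longrightarrow> norm (W t x) \<le> P"
    if W: "uniformly_continuous_on ({0..} \<times> orthant) (\<lambda>(t, x). W t x)"
    for W :: "real \<Rightarrow> real ^ 'n \<Rightarrow> real ^ 'n"
  proof -
    have "compact ((\<lambda>z. W (fst z) (snd z)) ` ({0..M} \<times> orthant_ball R))"
      by (intro compact_continuous_image cont[OF W] compact_Times compact_Icc compact_orthant_ball
          continuous_intros) (auto dest: orthant_ballD(1))
    then obtain P where "\<forall>w\<in>(\<lambda>z. W (fst z) (snd z)) ` ({0..M} \<times> orthant_ball R). norm w \<le> P"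
      using compact_imp_bounded bounded_iff by blast
    then show ?thesis by (intro exI[of _ P]) force
  qed
  obtain P1 where P1: "\<And>t x. 0 \<le> t \<Longrightarrow> t \<le> M \<Longrightarrow> x \<in> orthant_ball R \<Longrightarrow> norm (U t x) \<le> P1"
    using bdd[OF ucU] by blast
  obtain P2 where P2: "\<And>t x. 0 \<le> t \<Longrightarrow> t \<le> M \<Longrightarrow> x \<in> orthant_ball R \<Longrightarrow> norm (V t x) \<le> P2"
    using bdd[OF ucV] by blast
  obtain C1 where C1: "C1 \<ge> 0" "\<And>x p. x \<in> orthant_ball R \<Longrightarrow> norm p \<le> max P1 P2 \<Longrightarrow> F x p \<bullet> x \<le> C1"
    using monotone_pair_inner_bounded_above[OF GF] by blast

  \<comment> \<open>The first bound keeps the concave penalties below a fraction of \<eta>; the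
    second keeps the two \<open>F\<close> errors, together at most
    \<open>4 * (\<kappa> * C1)\<close>, below \<delta>/2.\<close>
  define \<kappa> where "\<kappa> = min (\<eta> / (8 * (1 + R\<^sup>2))) (\<delta> / (8 * (1 + C1)))"
  have \<kappa>: "\<kappa> > 0" using \<eta> \<delta>(1) C1(1) by (auto simp: \<kappa>_def add_pos_nonneg)
  have \<kappa>R: "2 * (\<kappa> * R\<^sup>2) \<le> \<eta> / 4"
  proof -
    have "\<kappa> * R\<^sup>2 \<le> \<eta> / (8 * (1 + R\<^sup>2)) * (1 + R\<^sup>2)"
      using \<eta> by (intro mult_mono) (auto simp: \<kappa>_def)
    also have "\<dots> = \<eta> / 8" using \<eta> by (simp add: field_simps add_pos_nonneg add_nonneg_eq_0_iff)
    finally show ?thesis by simp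
  qed
  have \<kappa>C: "4 * (\<kappa> * C1) \<le> \<delta> / 2"
  proof -
    have "\<kappa> * C1 \<le> \<delta> / (8 * (1 + C1)) * (1 + C1)"
      using \<delta> C1(1) by (intro mult_mono) (auto simp: \<kappa>_def)
    also have "\<dots> = \<delta> / 8" using C1(1) by (simp add: field_simps)
    finally show ?thesis by simp
  qed

  obtain L0 where L0: "L0 > 0" "\<And>x. norm (T x) \<le> L0 * norm x"
    using linear_bounded_pos[OF T(1)] by blast
  define L where "L = (2 * R + 1) * (L0 + 1)"
  have L: "L > 0" using R L0(1) by (simp add: L_def)
  have Lxy: "norm (x - y) \<le> L" "norm (T x - T y) \<le> L"
    if "x \<in> orthant_ball R" "y \<in> orthant_ball R" for x y
  proof -
    have xy: "norm (x - y) \<le> 2 * R + 1"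
      using norm_triangle_ineq4[of x y] orthant_ballD(2)[OF that(1)] orthant_ballD(2)[OF that(2)]
      by linarith
    also have "\<dots> \<le> L" using R L0(1) by (simp add: L_def algebra_simps)
    finally show "norm (x - y) \<le> L" .
    have "norm (T x - T y) \<le> L0 * norm (x - y)"
      using L0(2)[of "x - y"] by (simp add: linear_diff[OF T(1)])
    also have "\<dots> \<le> (L0 + 1) * (2 * R + 1)" using xy L0(1) R by (intro mult_mono) auto
    finally show "norm (T x - T y) \<le> L" by (simp add: L_def mult.commute)
  qed

  \<comment> \<open>The first bound excludes a minimum at time 0. The second pays for moving both
    solutions to a common time in the nonlocal term.\<close>
  define \<rho> where "\<rho> = min (\<eta> / (8 * L)) (\<delta> / (8 * (lam * L)))"
  have \<rho>: "\<rho> > 0" using \<eta> \<delta>(1) L lam by (auto simp: \<rho>_def)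
  have \<rho>L: "\<rho> * L \<le> \<eta> / 8" "lam * (\<rho> * L) \<le> \<delta> / 8"
  proof -
    have "\<rho> * L \<le> \<eta> / (8 * L) * L" using L by (intro mult_right_mono) (auto simp: \<rho>_def)
    then show "\<rho> * L \<le> \<eta> / 8" using L by simp
    have "\<rho> * (lam * L) \<le> \<delta> / (8 * (lam * L)) * (lam * L)"
      using L lam by (intro mult_right_mono) (auto simp: \<rho>_def)
    then show "lam * (\<rho> * L) \<le> \<delta> / 8" using L lam by (simp add: mult_ac)
  qed
  obtain d1 where d1: "d1 > 0"
    "\<And>t s x. 0 \<le> t \<Longrightarrow> 0 \<le> s \<Longrightarrow> \<bar>t - s\<bar> < d1 \<Longrightarrow> x \<in> orthant \<Longrightarrow> norm (U t x - U s x) < \<rho>"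
    using uniformly_continuous_on_time_modulus[OF ucU \<rho>] by blast
  obtain d2 where d2: "d2 > 0"
    "\<And>t s x. 0 \<le> t \<Longrightarrow> 0 \<le> s \<Longrightarrow> \<bar>t - s\<bar> < d2 \<Longrightarrow> x \<in> orthant \<Longrightarrow> norm (V t x - V s x) < \<rho>"
    using uniformly_continuous_on_time_modulus[OF ucV \<rho>] by blast
  define d where "d = min d1 d2"
  have d: "d > 0" using d1(1) d2(1) by (simp add: d_def)
  \<comment> \<open>\<open>Q\<close> bounds |w| at the minimum, so
    \<open>a * (t0 - s0)\<^sup>2 < Q + 1\<close>; the choice of \<open>a\<close> turns this into |t0
    - s0| < d.\<close>
  define Q where "Q = (P1 + P2) * L"
  have "norm (U t1 x1) \<le> P1" "norm (V t1 y1) \<le> P2" using P1 P2 t1 x1 y1 by auto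
  then have P: "P1 \<ge> 0" "P2 \<ge> 0" using norm_ge_zero order_trans by blast+
  then have Q: "Q \<ge> 0" using L by (simp add: Q_def)
  define a where "a = (Q + 1) / d\<^sup>2"
  have a: "a > 0" using Q d by (simp add: a_def)

  define \<Phi> where "\<Phi> = (\<lambda>t s x y. (U t x - V s y) \<bullet> (x - y) + a * (t - s)\<^sup>2
    + b * (exp (c * t) + exp (c * s)) + \<delta> * (t + s) - \<kappa> * (x \<bullet> x) - \<kappa> * (y \<bullet> y))"
  have "\<exists>z\<in>K. \<forall>z'\<in>K. (\<lambda>z. \<Phi> (fst z) (fst (snd z)) (fst (snd (snd z))) (snd (snd (snd z)))) z
      \<le> (\<lambda>z. \<Phi> (fst z) (fst (snd z)) (fst (snd (snd z))) (snd (snd (snd z)))) z'"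
  proof (rule continuous_attains_inf[OF K])
    show "K \<noteq> {}" using t1 x1 y1 by (auto simp: K_def)
    show "continuous_on K (\<lambda>z. \<Phi> (fst z) (fst (snd z)) (fst (snd (snd z))) (snd (snd (snd z))))"
      unfolding \<Phi>_def
      by (intro continuous_intros cont[OF ucU] cont[OF ucV]) (auto simp: K_def dest: orthant_ballD(1))
  qed
  then obtain t0 s0 x0 y0 where z0: "(t0, s0, x0, y0) \<in> K"
    and min0: "\<And>t s x y. (t, s, x, y) \<in> K \<Longrightarrow> \<Phi> t0 s0 x0 y0 \<le> \<Phi> t s x y"
    by (force simp: Ball_def)
  have t0: "0 \<le> t0" "t0 \<le> M" and s0: "0 \<le> s0" "s0 \<le> M"
    and x0: "x0 \<in> orthant_ball R" and y0: "y0 \<in> orthant_ball R"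
    using z0 by (auto simp: K_def)
  note x0o = orthant_ballD(1)[OF x0] and y0o = orthant_ballD(1)[OF y0]
  define w where "w = (U t0 x0 - V s0 y0) \<bullet> (x0 - y0)"

  have \<Phi>0: "\<Phi> t0 s0 x0 y0 \<le> - \<eta> / 2"
  proof -
    have "\<Phi> t0 s0 x0 y0 \<le> \<Phi> t1 t1 x1 y1" using t1 x1 y1 by (intro min0) (auto simp: K_def)
    \<comment> \<open>On the diagonal the time penalty vanishes, and the concave terms only lower
      the value.\<close>
    also have "\<dots> \<le> - \<eta> + 2 * (\<delta> * t1)"
      using mult_nonneg_nonneg[OF less_imp_le[OF \<kappa>] inner_ge_zero[of x1]]
        mult_nonneg_nonneg[OF less_imp_le[OF \<kappa>] inner_ge_zero[of y1]]
      by (simp add: \<Phi>_def \<eta>_def algebra_simps)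
    also have "\<dots> \<le> - \<eta> + 2 * (\<delta> * M)" using t1 \<delta>(1) by simp
    finally show ?thesis using \<delta>(2) by simp
  qed
  have sq: "\<kappa> * (x \<bullet> x) \<le> \<eta> / 8" if "x \<in> orthant_ball R" for x :: "real ^ 'n"
  proof -
    have "x \<bullet> x \<le> R\<^sup>2"
      using orthant_ballD(2)[OF that] by (simp add: dot_square_norm power_mono)
    then have "\<kappa> * (x \<bullet> x) \<le> \<kappa> * R\<^sup>2" using \<kappa> by simp
    then show ?thesis using \<kappa>R by simp
  qed
  have wa: "w + a * (t0 - s0)\<^sup>2 \<le> - \<eta> / 4"
  proof -
    have "0 \<le> b * (exp (c * t0) + exp (c * s0))" "0 \<le> \<delta> * (t0 + s0)"
      using b(1) \<delta>(1) t0 s0 by auto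
    then show ?thesis using \<Phi>0 sq[OF x0] sq[OF y0] by (simp add: \<Phi>_def w_def)
  qed
  define wT where "wT = (U t0 (T x0) - V s0 (T y0)) \<bullet> (T x0 - T y0)"
  have w_neg: "w \<le> - \<eta> / 4"
    using wa mult_nonneg_nonneg[OF less_imp_le[OF a] zero_le_power2[of "t0 - s0"]] by linarith
  have ts: "\<bar>t0 - s0\<bar> < d"
  proof -
    have "norm (U t0 x0 - V s0 y0) \<le> P1 + P2"
      using norm_triangle_ineq4[of "U t0 x0" "V s0 y0"] P1[OF t0 x0] P2[OF s0 y0] by linarith
    then have "norm (U t0 x0 - V s0 y0) * norm (x0 - y0) \<le> Q"
      unfolding Q_def using Lxy(1)[OF x0 y0] P by (intro mult_mono) auto
    then have "- Q \<le> w"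
      using Cauchy_Schwarz_ineq2[of "U t0 x0 - V s0 y0" "x0 - y0"] unfolding w_def by linarith
    then have "a * (t0 - s0)\<^sup>2 < Q + 1" using wa \<eta> by linarith
    also have "Q + 1 = a * d\<^sup>2" using d by (simp add: a_def)
    finally have "(t0 - s0)\<^sup>2 < d\<^sup>2" using a by simp
    then show ?thesis using d by (metis abs_le_square_iff abs_of_pos not_le)
  qed

  have small: "\<bar>p \<bullet> q\<bar> \<le> \<rho> * L" if "norm p < \<rho>" "norm q \<le> L" for p q :: "real ^ 'n"
    using Cauchy_Schwarz_ineq2[of p q] mult_mono[of "norm p" \<rho> "norm q" L] that \<rho> by auto
  \<comment> \<open>At time 0 the initial monotonicity applies after replacing \<open>V s0\<close>
    by \<open>V 0\<close>, at a cost of at most \<eta>/8, which contradicts w \<le>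
    -\<eta>/4.\<close>
  have t0_pos: "t0 > 0"
  proof (rule ccontr)
    assume "\<not> 0 < t0"
    then have t00: "t0 = 0" using t0 by simp
    then have "\<bar>(V s0 y0 - V 0 y0) \<bullet> (x0 - y0)\<bar> \<le> \<rho> * L"
      using ts s0 y0o by (intro small Lxy(1) x0 y0 d2(2)) (auto simp: d_def)
    then show False using init[OF x0o y0o] w_neg \<rho>L(1) \<eta>
      by (simp add: w_def t00 inner_diff_left)
  qed
  have s0_pos: "s0 > 0"
  proof (rule ccontr)
    assume "\<not> 0 < s0"
    then have s00: "s0 = 0" using s0 by simp
    then have "\<bar>(U t0 x0 - U 0 x0) \<bullet> (x0 - y0)\<bar> \<le> \<rho> * L"
      using ts t0 x0o by (intro small Lxy(1) x0 y0 d1(2)) (auto simp: d_def)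
    then show False using init[OF x0o y0o] w_neg \<rho>L(1) \<eta>
      by (simp add: w_def s00 inner_diff_left)
  qed

  have "F x0 (U t0 x0) \<bullet> (U t0 x0 - V s0 y0 - (2 * \<kappa>) *\<^sub>R x0) + G x0 (U t0 x0) \<bullet> (x0 - y0)
    \<le> - (2 * a * (t0 - s0)) - b * c * exp (c * t0) - \<delta> / 2
       + lam * (U t0 x0 \<bullet> (x0 - y0) - U t0 (T x0) \<bullet> (T x0 - T y0))"
  proof (rule test_inequality_at_penalised_minimum[OF tU T(1) y0o x0 t0_pos t0(2) \<kappa> \<delta>(1)])
    fix x :: "real ^ 'n" assume "x \<in> orthant_ball R"
    then have "\<Phi> t0 s0 x0 y0 \<le> \<Phi> t0 s0 x y0" using t0 s0 y0 by (intro min0) (auto simp: K_def)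
    then show "(U t0 x0 - V s0 y0) \<bullet> (x0 - y0) - \<kappa> * (x0 \<bullet> x0)
        \<le> (U t0 x - V s0 y0) \<bullet> (x - y0) - \<kappa> * (x \<bullet> x)"
      by (simp add: \<Phi>_def)
  next
    fix t assume "0 \<le> t" "t \<le> M"
    then have "\<Phi> t0 s0 x0 y0 \<le> \<Phi> t s0 x0 y0" using x0 s0 y0 by (intro min0) (auto simp: K_def)
    then show "U t0 x0 \<bullet> (x0 - y0) + a * (t0 - s0)\<^sup>2 + b * exp (c * t0) + \<delta> * t0
        \<le> U t x0 \<bullet> (x0 - y0) + a * (t - s0)\<^sup>2 + b * exp (c * t) + \<delta> * t"
      by (simp add: \<Phi>_def inner_diff_left distrib_left)
  qed
  moreover
  have "F y0 (V s0 y0) \<bullet> (V s0 y0 - U t0 x0 - (2 * \<kappa>) *\<^sub>R y0) + G y0 (V s0 y0) \<bullet> (y0 - x0)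
    \<le> - (2 * a * (s0 - t0)) - b * c * exp (c * s0) - \<delta> / 2
       + lam * (V s0 y0 \<bullet> (y0 - x0) - V s0 (T y0) \<bullet> (T y0 - T x0))"
  proof (rule test_inequality_at_penalised_minimum[OF tV T(1) x0o y0 s0_pos s0(2) \<kappa> \<delta>(1)])
    have flip: "(V s0 y - U t0 x0) \<bullet> (y - x0) = (U t0 x0 - V s0 y) \<bullet> (x0 - y)" for y
      by (simp add: inner_diff_left inner_diff_right)
    fix y :: "real ^ 'n" assume "y \<in> orthant_ball R"
    then have "\<Phi> t0 s0 x0 y0 \<le> \<Phi> t0 s0 x0 y" using t0 s0 x0 by (intro min0) (auto simp: K_def)
    then show "(V s0 y0 - U t0 x0) \<bullet> (y0 - x0) - \<kappa> * (y0 \<bullet> y0)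
        \<le> (V s0 y - U t0 x0) \<bullet> (y - x0) - \<kappa> * (y \<bullet> y)"
      by (simp add: \<Phi>_def flip)
  next
    fix s assume "0 \<le> s" "s \<le> M"
    then have "\<Phi> t0 s0 x0 y0 \<le> \<Phi> t0 s x0 y0" using x0 t0 y0 by (intro min0) (auto simp: K_def)
    then show "V s0 y0 \<bullet> (y0 - x0) + a * (s0 - t0)\<^sup>2 + b * exp (c * s0) + \<delta> * s0
        \<le> V s y0 \<bullet> (y0 - x0) + a * (s - t0)\<^sup>2 + b * exp (c * s) + \<delta> * s"
      by (simp add: \<Phi>_def inner_diff_left inner_diff_right distrib_left power2_commute)
  qed
  moreover have "0 \<le> (G x0 (U t0 x0) - G y0 (V s0 y0)) \<bullet> (x0 - y0)
      + (F x0 (U t0 x0) - F y0 (V s0 y0)) \<bullet> (U t0 x0 - V s0 y0)"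
    using GF x0o y0o by (simp add: monotone_pair_def)
  \<comment> \<open>In the sum the derivatives of the time penalty cancel, and monotonicity of the
    pair removes every \<open>F\<close> and \<open>G\<close> term except those carrying
    \<kappa>.\<close>
  ultimately have "- (2 * \<kappa> * (F x0 (U t0 x0) \<bullet> x0)) - 2 * \<kappa> * (F y0 (V s0 y0) \<bullet> y0)
      \<le> - (b * c * exp (c * t0)) - b * c * exp (c * s0) - \<delta> + lam * (w - wT)"
    by (simp add: w_def wT_def inner_diff_left inner_diff_right algebra_simps)
  moreover have "\<kappa> * (F x0 (U t0 x0) \<bullet> x0) \<le> \<kappa> * C1"
    using \<kappa> P1[OF t0 x0] by (intro mult_left_mono C1(2) x0) auto
  moreover have "\<kappa> * (F y0 (V s0 y0) \<bullet> y0) \<le> \<kappa> * C1"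
    using \<kappa> P2[OF s0 y0] by (intro mult_left_mono C1(2) y0) auto
  moreover have "lam * w \<le> 0" using lam w_neg \<eta> by (simp add: mult_le_0_iff)
  moreover have "- (lam * wT) \<le> b * c * exp (c * t0) + b * c * exp (c * s0) + \<delta> / 4"
  proof -
    \<comment> \<open>The bound \<open>lower\<close> is available only at equal times. The earlier
      time is chosen because \<open>exp (c * m)\<close> is then below both exponentials.\<close>
    define m where "m = min t0 s0"
    have m: "0 \<le> m" "m \<le> M" "\<bar>t0 - m\<bar> < d" "\<bar>s0 - m\<bar> < d"
      using t0 s0 ts d by (auto simp: m_def min_def)
    have Tx0: "T x0 \<in> orthant" and Ty0: "T y0 \<in> orthant" using T(2) x0o y0o by auto
    have "\<bar>(U t0 (T x0) - U m (T x0)) \<bullet> (T x0 - T y0)\<bar> \<le> \<rho> * L"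
      using m t0 Tx0 by (intro small Lxy(2) x0 y0 d1(2)) (auto simp: d_def)
    moreover have "\<bar>(V s0 (T y0) - V m (T y0)) \<bullet> (T x0 - T y0)\<bar> \<le> \<rho> * L"
      using m s0 Ty0 by (intro small Lxy(2) x0 y0 d2(2)) (auto simp: d_def)
    moreover have "- (B * exp (c * m)) \<le> (U m (T x0) - V m (T y0)) \<bullet> (T x0 - T y0)"
      by (rule lower[OF m(1,2) x0 y0])
    ultimately have "- wT \<le> B * exp (c * m) + 2 * (\<rho> * L)"
      by (simp add: wT_def inner_diff_left)
    then have "lam * - wT \<le> lam * (B * exp (c * m) + 2 * (\<rho> * L))"
      using lam by (intro mult_left_mono) auto
    then have "- (lam * wT) \<le> 2 * (b * c) * exp (c * m) + 2 * (lam * (\<rho> * L))"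
      unfolding b(2) by (simp add: algebra_simps)
    moreover have "b * c * exp (c * m) \<le> b * c * exp (c * t0)" "b * c * exp (c * m) \<le> b * c * exp (c * s0)"
      using b(1) c by (auto simp: m_def intro!: mult_left_mono)
    ultimately show ?thesis using \<rho>L(2) by linarith
  qed
  ultimately show False using \<kappa>C \<delta>(1) by (simp add: algebra_simps)
qed

section \<open>Growth and radii for the iteration\<close>

lemma convex_orthant: "convex (orthant :: (real ^ 'n) set)"
  by (auto simp: convex_def orthant_def)

lemma uniformly_continuous_on_orthant_linear_growth:
  fixes U :: "real \<Rightarrow> real ^ 'n \<Rightarrow> real ^ 'n"
  assumes "uniformly_continuous_on ({0..} \<times> orthant) (\<lambda>(t, x). U t x)"
  obtains C where "C > 0"
    and "\<And>t x. 0 \<le> t \<Longrightarrow> x \<in> orthant \<Longrightarrow> norm (U t x) \<le> C * (1 + t + norm x)"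
proof -
  have z: "(0 :: real \<times> (real ^ 'n)) \<in> {0..} \<times> orthant" by (simp add: zero_prod_def orthant_def)
  obtain C where C: "C > 0"
    "\<And>z. z \<in> {0..} \<times> orthant \<Longrightarrow> norm ((\<lambda>(t, x). U t x) z) \<le> C * (1 + norm z)"
    using uniformly_continuous_on_linear_growth[OF assms
        convex_Times[OF convex_real_interval(1) convex_orthant] z] by blast
  show ?thesis
  proof (rule that[OF C(1)])
    fix t :: real and x :: "real ^ 'n" assume tx: "0 \<le> t" "x \<in> orthant"
    have "norm (U t x) \<le> C * (1 + norm (t, x))" using C(2)[of "(t, x)"] tx by simp
    also have "\<dots> \<le> C * (1 + t + norm x)"
      using C(1) norm_Pair_le[of t x] tx(1) by (intro mult_left_mono) auto
    finally show "norm (U t x) \<le> C * (1 + t + norm x)" .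
  qed
qed

lemma monotone_solution_test_inequality:
  assumes "monotone_solution F G lam T U0 U"
  obtains R0 where "R0 > 0" and "\<And>R. R \<ge> R0 \<Longrightarrow> test_inequality F G lam T U R"
proof -
  obtain R0 where "R0 > 0" and R0: "\<forall>V. \<forall>y\<in>orthant. \<forall>R\<ge>R0. \<forall>t0>0. \<forall>x0\<in>orthant_ball R. \<forall>\<phi>.
        strict_min_at (\<lambda>x. (U t0 x - V) \<bullet> (x - y)) (orthant_ball R) x0 \<longrightarrow>
        smooth_fun \<phi> \<longrightarrow>
        (\<exists>\<epsilon>>0. \<forall>t\<in>{t0 - \<epsilon><..<t0}. \<phi> t < U t x0 \<bullet> (x0 - y)) \<longrightarrow>
        \<phi> t0 = U t0 x0 \<bullet> (x0 - y) \<longrightarrow>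
        deriv \<phi> t0 + lam * ((U t0 x0 - adjoint T (U t0 (T x0))) \<bullet> (x0 - y))
          \<ge> F x0 (U t0 x0) \<bullet> (U t0 x0 - V) + G x0 (U t0 x0) \<bullet> (x0 - y)"
    using assms unfolding monotone_solution_def by blast
  show ?thesis
    by (rule that[OF \<open>R0 > 0\<close>]) (use R0 in \<open>simp only: test_inequality_def, blast\<close>)
qed

lemma linear_orthant_ball_image:
  fixes T :: "real ^ 'n \<Rightarrow> real ^ 'n"
  assumes T: "linear T" "T ` orthant \<subseteq> orthant"
  obtains k where "k \<ge> 1" and "\<And>R x. x \<in> orthant_ball R \<Longrightarrow> T x \<in> orthant_ball (k * R)"
proof -
  obtain L where L: "L > 0" "\<And>x. norm (T x) \<le> L * norm x"
    using linear_bounded_pos[OF T(1)] by blast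
  \<comment> \<open>The factor \<open>real CARD('n)\<close> passes from the norm to the coordinate
    sum. The added 1 gives \<open>k \<ge> 1\<close>, so enlarged radii stay above the
    threshold.\<close>
  define k where "k = 1 + real CARD('n) * L"
  show ?thesis
  proof (rule that)
    show "k \<ge> 1" using L(1) by (simp add: k_def)
    fix R x assume x: "x \<in> (orthant_ball R :: (real ^ 'n) set)"
    have nx: "norm x \<le> R" by (rule orthant_ballD(2)[OF x])
    then have R: "0 \<le> R" using norm_ge_zero order_trans by blast
    have "norm (T x) \<le> L * R"
      using L(2)[of x] mult_left_mono[OF nx less_imp_le[OF L(1)]] by linarith
    then have "real CARD('n) * norm (T x) \<le> real CARD('n) * (L * R)"
      by (intro mult_left_mono) auto
    also have "\<dots> \<le> k * R" using R by (simp add: k_def algebra_simps)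
    finally show "T x \<in> orthant_ball (k * R)"
      using T(2) orthant_ballD(1)[OF x] by (intro orthant_ballI) auto
  qed
qed

section \<open>Uniqueness by iterating over radii\<close>

theorem theorem2p2:
  fixes F G :: "real ^ 'n \<Rightarrow> real ^ 'n \<Rightarrow> real ^ 'n"
    and U0 :: "real ^ 'n \<Rightarrow> real ^ 'n"
    and lam :: real
    and T :: "real ^ 'n \<Rightarrow> real ^ 'n"
    and U1 U2 :: "real \<Rightarrow> real ^ 'n \<Rightarrow> real ^ 'n"
  assumes "CARD('n) > 1"
    and "lam > 0"
    and "linear T"
    and "\<And>x p i. x \<in> orthant \<Longrightarrow> x $ i = 0 \<Longrightarrow> F x p $ i \<le> 0"
    and "T ` orthant \<subseteq> orthant"
    and "monotone_on_orthant U0"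
    and "monotone_pair G F"
    and "uniformly_continuous_on ({0..} \<times> orthant) (\<lambda>(t, x). U1 t x)"
    and "monotone_solution F G lam T U0 U1"
    and "uniformly_continuous_on ({0..} \<times> orthant) (\<lambda>(t, x). U2 t x)"
    and "monotone_solution F G lam T U0 U2"
  shows "\<forall>t\<ge>0. \<forall>x\<in>orthant. U1 t x = U2 t x"
proof (intro allI impI ballI)
  \<comment> \<open>The time at which equality is to be shown also serves as the time horizon
    \<open>M\<close>.\<close>
  fix M :: real and x' :: "real ^ 'n"
  assume M: "0 \<le> M" and x': "x' \<in> orthant"
  obtain R1 where R1: "R1 > 0" "\<And>R. R \<ge> R1 \<Longrightarrow> test_inequality F G lam T U1 R"
    using monotone_solution_test_inequality[OF assms(9)] by blast
  obtain R2 where R2: "R2 > 0" "\<And>R. R \<ge> R2 \<Longrightarrow> test_inequality F G lam T U2 R"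
    using monotone_solution_test_inequality[OF assms(11)] by blast
  \<comment> \<open>Radii of at least 1 allow the constant and time terms of the linear growth bound
    to be absorbed into a multiple of \<open>R\<close>.\<close>
  define R0 where "R0 = max 1 (max R1 R2)"
  obtain k where k: "k \<ge> 1" "\<And>R x. x \<in> orthant_ball R \<Longrightarrow> T x \<in> orthant_ball (k * R)"
    using linear_orthant_ball_image[OF assms(3,5)] by blast
  define c where "c = 2 * lam * k\<^sup>2"
  have c: "c > 0" using assms(2) k(1) by (simp add: c_def)
  have init: "0 \<le> (U1 0 x - U2 0 y) \<bullet> (x - y)" if "x \<in> orthant" "y \<in> orthant" for x y
    using assms(6,9,11) that by (simp add: monotone_on_orthant_def monotone_solution_def)
  \<comment> \<open>Quantifying over all large \<open>R\<close> lets the bound at radius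
    \<open>k * R\<close> feed the step at radius \<open>R\<close>; the \<open>R\<^sup>2\<close>
    weight costs a factor \<open>k\<^sup>2\<close>, which \<open>c\<close> compensates.\<close>
  define lower where "lower = (\<lambda>C. \<forall>R\<ge>R0. \<forall>x\<in>orthant_ball R. \<forall>y\<in>orthant_ball R. \<forall>t\<in>{0..M}.
      - (C * R\<^sup>2 * exp (c * t)) \<le> (U1 t x - U2 t y) \<bullet> (x - y))"
  have step: "lower (C / 2)" if C: "lower C" "C \<ge> 0" for C
    unfolding lower_def
  proof (intro allI impI ballI)
    fix R t :: real and x y :: "real ^ 'n"
    assume R: "R0 \<le> R" and x: "x \<in> orthant_ball R" and y: "y \<in> orthant_ball R" and t: "t \<in> {0..M}"
    have "1 \<le> R" using R by (simp add: R0_def)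
    then have kR: "R0 \<le> k * R" using R mult_right_mono[OF k(1), of R] by linarith
    have "- (lam * (C * (k * R)\<^sup>2) / c * exp (c * t)) \<le> (U1 t x - U2 t y) \<bullet> (x - y)"
    proof (rule comparison_step[OF assms(2,3,5,7,8,10) _ _ init c])
      show "test_inequality F G lam T U1 R" "test_inequality F G lam T U2 R"
        using R R1(2) R2(2) by (auto simp: R0_def)
      show "- (C * (k * R)\<^sup>2 * exp (c * t)) \<le> (U1 t (T x) - U2 t (T y)) \<bullet> (T x - T y)"
        if "0 \<le> t" "t \<le> M" "x \<in> orthant_ball R" "y \<in> orthant_ball R" for t x y
        using C(1) kR k(2) that unfolding lower_def by simp
    qed (use C x y t in auto)
    moreover have "lam * (C * (k * R)\<^sup>2) / c = C / 2 * R\<^sup>2"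
      using assms(2) k(1) by (simp add: c_def power_mult_distrib)
    ultimately show "- (C / 2 * R\<^sup>2 * exp (c * t)) \<le> (U1 t x - U2 t y) \<bullet> (x - y)" by simp
  qed
  obtain C1 where C1: "C1 > 0"
    "\<And>t x. 0 \<le> t \<Longrightarrow> x \<in> orthant \<Longrightarrow> norm (U1 t x) \<le> C1 * (1 + t + norm x)"
    using uniformly_continuous_on_orthant_linear_growth[OF assms(8)] by blast
  obtain C2 where C2: "C2 > 0"
    "\<And>t x. 0 \<le> t \<Longrightarrow> x \<in> orthant \<Longrightarrow> norm (U2 t x) \<le> C2 * (1 + t + norm x)"
    using uniformly_continuous_on_orthant_linear_growth[OF assms(10)] by blast
  \<comment> \<open>Each solution contributes its growth constant times \<open>(2 + M) * R\<close>,
    and the last factor 2 comes from |x - y| \<le> 2R.\<close>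
  define C where "C = (C1 + C2) * (2 + M) * 2"
  have C: "C \<ge> 0" using C1(1) C2(1) M by (simp add: C_def)
  have "lower C"
    unfolding lower_def
  proof (intro allI impI ballI)
    fix R t :: real and x y :: "real ^ 'n"
    assume "R0 \<le> R" and x: "x \<in> orthant_ball R" and y: "y \<in> orthant_ball R" and t: "t \<in> {0..M}"
    then have R: "1 \<le> R" by (simp add: R0_def)
    note nx = orthant_ballD[OF x] and ny = orthant_ballD[OF y]
    have g: "1 + t + norm z \<le> (2 + M) * R" if "norm z \<le> R" for z :: "real ^ 'n"
    proof -
      have "(1 + M) * 1 \<le> (1 + M) * R" using R M by (intro mult_left_mono) auto
      then have "1 + t \<le> (1 + M) * R" using t by (auto simp: algebra_simps)
      then show ?thesis using that by (simp add: algebra_simps)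
    qed
    have "norm (U1 t x - U2 t y) \<le> norm (U1 t x) + norm (U2 t y)" by (rule norm_triangle_ineq4)
    also have "\<dots> \<le> C1 * (1 + t + norm x) + C2 * (1 + t + norm y)"
      using C1(2) C2(2) nx(1) ny(1) t by (intro add_mono) auto
    also have "\<dots> \<le> C1 * ((2 + M) * R) + C2 * ((2 + M) * R)"
      using C1(1) C2(1) g nx(2) ny(2) by (intro add_mono mult_left_mono) auto
    finally have "norm (U1 t x - U2 t y) \<le> (C1 + C2) * (2 + M) * R" by (simp add: algebra_simps)
    moreover have "norm (x - y) \<le> 2 * R"
      using norm_triangle_ineq4[of x y] nx(2) ny(2) by linarith
    ultimately have "norm (U1 t x - U2 t y) * norm (x - y) \<le> (C1 + C2) * (2 + M) * R * (2 * R)"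
      using C1(1) C2(1) M R by (intro mult_mono) auto
    also have "\<dots> = C * R\<^sup>2 * 1" by (simp add: C_def power2_eq_square)
    also have "\<dots> \<le> C * R\<^sup>2 * exp (c * t)" using C c t by (intro mult_left_mono) auto
    finally show "- (C * R\<^sup>2 * exp (c * t)) \<le> (U1 t x - U2 t y) \<bullet> (x - y)"
      using Cauchy_Schwarz_ineq2[of "U1 t x - U2 t y" "x - y"] by linarith
  qed
  then have lower: "lower (C / 2 ^ n)" for n
  proof (induction n)
    case (Suc n)
    then show ?case using step[of "C / 2 ^ n"] C by (simp add: mult.commute)
  qed simp
  have "0 \<le> (U1 M x - U2 M y) \<bullet> (x - y)" if xy: "x \<in> orthant" "y \<in> orthant" for x y
  proof -
    \<comment> \<open>The radius is fixed before \<open>n\<close> tends to infinity, so the lower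
      bound tends to 0.\<close>
    define R where "R = R0 + real CARD('n) * norm x + real CARD('n) * norm y"
    have "0 \<le> R0" by (simp add: R0_def)
    then have "R0 \<le> R" "x \<in> orthant_ball R" "y \<in> orthant_ball R"
      using xy by (auto simp: R_def intro!: orthant_ballI)
    then have "- (C / 2 ^ n * R\<^sup>2 * exp (c * M)) \<le> (U1 M x - U2 M y) \<bullet> (x - y)" for n
      using lower[of n] M unfolding lower_def by simp
    moreover have "(\<lambda>n. - (C / 2 ^ n * R\<^sup>2 * exp (c * M))) \<longlonglongrightarrow> - (0 * R\<^sup>2 * exp (c * M))"
      by (intro tendsto_intros LIMSEQ_divide_realpow_zero) auto
    ultimately show ?thesis
      using LIMSEQ_le_const2[of _ "- (0 * R\<^sup>2 * exp (c * M))"] by simp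
  qed
  moreover have "continuous_on orthant (W M)"
    if "uniformly_continuous_on ({0..} \<times> orthant) (\<lambda>(t, x). W t x)"
    for W :: "real \<Rightarrow> real ^ 'n \<Rightarrow> real ^ 'n"
  proof -
    have "continuous_on orthant (\<lambda>x :: real ^ 'n. (M, x))" by (intro continuous_intros)
    then have "continuous_on orthant (\<lambda>x. (\<lambda>(t, x). W t x) (M, x))"
      using M by (intro continuous_on_compose2[OF uniformly_continuous_imp_continuous[OF that]]) auto
    then show ?thesis by simp
  qed
  ultimately show "U1 M x' = U2 M x'"
    using eq_on_orthant_of_cross_monotone x' assms(8,10) by blast
qed

end
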